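(* Let $F(x)=\frac{x}{1+x}$. For every reduced fraction $x\in[0,1]$, $$H(x)=\begin{cases}(1+x)\,H(F(x)), & x\in[0,1/2],\\[2pt] (1+x)\,H(F(x))-x\log x+(2x-1)\log(2x-1)+(1-x)\log(1-x), & x\in[1/2,1].\end{cases}$$
   Context: Farey binary tree: $\ell_1=\{0/1,1/1\}$, $\ell_{n+1}$ = mediants $\frac{p+p'}{q+q'}$ of pairs $p/q<p'/q'$ adjacent in $\bigcup_{i\le n}\ell_i$; each reduced $p/q\in(0,1)$ is the mediant of a unique adjacent pair $p_1/q_1<p_2/q_2$ (its parents). Haros graphs: $G_0$ has two nodes joined by an edge. For ordered-node graphs $G$ ($v_1,\dots,v_a$) and $G'$ ($w_1,\dots,w_b$), $G\oplus G'$ has nodes $u_1,\dots,u_{a+b-1}$ obtained by identifying $v_a$ with $w_1$, keeping all edges, and adding an edge $u_1u_{a+b-1}$. $G_{0/1}=G_{1/1}=G_0$, $G_{p/q}=G_{p_1/q_1}\oplus G_{p_2/q_2}$ ($q+1$ nodes). Degree convention: the first and last nodes are identified into one boundary node whose degree is the sum of their degrees, giving $q$ nodes; $P(k,p/q)$ is the fraction of them with degree $k$. Entropy: $S(x)=-\sum_{k\ge2}P(k,x)\log P(k,x)$, with $0\log0=0$. Reduced entropy: $H(x)=S(x)+2x\log x+(1-2x)\log(1-2x)$ for $x\in[0,1/2]$ and $H(x)=S(x)+2(1-x)\log(1-x)+(2x-1)\log(2x-1)$ for $x\in[1/2,1]$. *)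

theory Defs
  imports "HOL-Analysis.Analysis"
begin

abbreviation num :: "rat \<Rightarrow> int" where "num x \<equiv> fst (quotient_of x)"
abbreviation den :: "rat \<Rightarrow> int" where "den x \<equiv> snd (quotient_of x)"

definition mediant :: "rat \<Rightarrow> rat \<Rightarrow> rat" where
  "mediant a b = Fract (num a + num b) (den a + den b)"

definition adjacent_in :: "rat set \<Rightarrow> rat \<Rightarrow> rat \<Rightarrow> bool" where
  "adjacent_in A a b \<longleftrightarrow> a \<in> A \<and> b \<in> A \<and> a < b \<and> (\<forall>c\<in>A. \<not> (a < c \<and> c < b))"

text \<open>The levels are numbered from 1; level 0 is a dummy.\<close>

fun farey_level :: "nat \<Rightarrow> rat set" where
  "farey_level 0 = {}"
| "farey_level (Suc 0) = {0, 1}"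
| "farey_level (Suc (Suc n)) =
     {mediant a b | a b. adjacent_in (\<Union>i\<in>{1..Suc n}. farey_level i) a b}"

definition farey_upto :: "nat \<Rightarrow> rat set" where
  "farey_upto n = (\<Union>i\<in>{1..n}. farey_level i)"

definition farey_parents :: "rat \<Rightarrow> rat \<Rightarrow> rat \<Rightarrow> bool" where
  "farey_parents a b x \<longleftrightarrow> (\<exists>n\<ge>1. adjacent_in (farey_upto n) a b \<and> x = mediant a b)"

text \<open>
  A pair \<^term>\<open>(n, E)\<close> is the graph with ordered nodes \<open>1, \<dots>, n\<close> and edge set \<open>E\<close>, an edge being the
  two-element set of its end points. No parallel edges ever arise in \<open>haros_sum\<close>, since the two
  summands share only one node.
\<close>

type_synonym ordered_graph = "nat \<times> nat set set"

definition G0 :: ordered_graph where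
  "G0 = (2, {{1, 2}})"

definition haros_sum :: "ordered_graph \<Rightarrow> ordered_graph \<Rightarrow> ordered_graph" where
  "haros_sum G G' =
     (let a = fst G; b = fst G'
      in (a + b - 1, snd G \<union> (\<lambda>e. (\<lambda>i. i + (a - 1)) ` e) ` snd G' \<union> {{1, a + b - 1}}))"

inductive is_haros_graph :: "rat \<Rightarrow> ordered_graph \<Rightarrow> bool" where
  zero: "is_haros_graph 0 G0"
| one: "is_haros_graph 1 G0"
| mediant: "farey_parents a b x \<Longrightarrow> is_haros_graph a G \<Longrightarrow> is_haros_graph b G'
     \<Longrightarrow> is_haros_graph x (haros_sum G G')"

definition haros_graph :: "rat \<Rightarrow> ordered_graph" where
  "haros_graph x = (THE G. is_haros_graph x G)"

definition node_degree :: "ordered_graph \<Rightarrow> nat \<Rightarrow> nat" where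
  "node_degree G v = card {e \<in> snd G. v \<in> e}"

text \<open>After identification of the first and the last node, node 1 stands for the boundary node.\<close>

definition bdegree :: "ordered_graph \<Rightarrow> nat \<Rightarrow> nat" where
  "bdegree G v = (if v = 1 then node_degree G 1 + node_degree G (fst G) else node_degree G v)"

definition degree_dist :: "nat \<Rightarrow> rat \<Rightarrow> real" where
  "degree_dist k x =
     real (card {v \<in> {1..fst (haros_graph x) - 1}. bdegree (haros_graph x) v = k})
       / real (fst (haros_graph x) - 1)"

definition haros_entropy :: "rat \<Rightarrow> real" where
  "haros_entropy x = - (\<Sum>\<^sub>\<infinity>k\<in>{2..}. degree_dist k x * ln (degree_dist k x))"

definition reduced_entropy :: "rat \<Rightarrow> real" where
  "reduced_entropy x = (let r = real_of_rat x in
     if x \<le> 1 / 2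
     then haros_entropy x + 2 * r * ln r + (1 - 2 * r) * ln (1 - 2 * r)
     else haros_entropy x + 2 * (1 - r) * ln (1 - r) + (2 * r - 1) * ln (2 * r - 1))"

definition farey_F :: "rat \<Rightarrow> rat" where
  "farey_F x = x / (1 + x)"

lemma farey_upto_1: "farey_upto (Suc 0) = {0, 1}"
  by (simp add: farey_upto_def)

lemma farey_level_Suc:
  "n \<ge> 1 \<Longrightarrow> farey_level (Suc n) = {mediant a b | a b. adjacent_in (farey_upto n) a b}"
  by (cases n) (simp_all add: farey_upto_def)

lemma farey_upto_Suc:
  assumes "n \<ge> 1"
  shows "farey_upto (Suc n) = farey_upto n \<union> {mediant a b | a b. adjacent_in (farey_upto n) a b}"
proof -
  have "farey_upto (Suc n) = farey_upto n \<union> farey_level (Suc n)"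
    unfolding farey_upto_def by (simp add: atLeastAtMostSuc_conv Un_commute)
  with assms show ?thesis by (simp add: farey_level_Suc)
qed

lemma farey_upto_mono: "m \<le> n \<Longrightarrow> farey_upto m \<subseteq> farey_upto n"
  unfolding farey_upto_def by fastforce

lemma den_pos: "den x > 0"
  by (metis prod.collapse quotient_of_denom_pos)

lemma rat_num_den: "x = of_int (num x) / of_int (den x)"
  by (metis prod.collapse quotient_of_div)

lemma less_iff_num_den: "x < y \<longleftrightarrow> num x * den y < num y * den x"
proof -
  have "x < y \<longleftrightarrow> of_int (num x) / of_int (den x) < (of_int (num y) / of_int (den y) :: rat)"
    by (simp only: rat_num_den[symmetric])
  also have "\<dots> \<longleftrightarrow> (of_int (num x * den y) :: rat) < of_int (num y * den x)"
    using den_pos[of x] den_pos[of y] by (simp add: divide_simps)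
  finally show ?thesis by (simp only: of_int_less_iff)
qed

lemma mediant_between:
  assumes "a < b" shows "a < mediant a b" "mediant a b < b"
proof -
  have *: "mediant a b = of_int (num a + num b) / of_int (den a + den b)"
    by (simp add: mediant_def Fract_of_int_quotient)
  have d: "(of_int (den a) :: rat) > 0" "(of_int (den b) :: rat) > 0" by (simp_all add: den_pos)
  have l: "of_int (num a) * of_int (den b) < (of_int (num b) * of_int (den a) :: rat)"
    using assms[unfolded less_iff_num_den] by (simp only: of_int_mult[symmetric] of_int_less_iff)
  have "of_int (num a) / of_int (den a) < mediant a b" unfolding *
    using d l by (simp add: divide_simps algebra_simps)
  then show "a < mediant a b" by (simp only: rat_num_den[symmetric])
  have "mediant a b < of_int (num b) / of_int (den b)" unfolding *
    using d l by (simp add: divide_simps algebra_simps)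
  then show "mediant a b < b" by (simp only: rat_num_den[symmetric])
qed

lemma adjacent_in_unique:
  assumes "adjacent_in A a b" "adjacent_in A c d" "a < x" "x < b" "c < x" "x < d"
  shows "a = c \<and> b = d"
proof -
  have "\<not> c < a" "\<not> a < c" "\<not> b < d" "\<not> d < b"
    using assms unfolding adjacent_in_def by (meson less_trans)+
  then show ?thesis by simp
qed

lemma farey_parents_unique:
  assumes "farey_parents a b x" "farey_parents c d x"
  shows "a = c \<and> b = d"
proof -
  have *: "\<not> m < n" if m: "m \<ge> 1" "adjacent_in (farey_upto m) a b" "x = mediant a b"
    and n: "adjacent_in (farey_upto n) c d" "x = mediant c d" for a b c d m n
  proof
    assume "m < n"
    have "x \<in> farey_upto (Suc m)" using m by (auto simp: farey_upto_Suc)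
    then have "x \<in> farey_upto n" using \<open>m < n\<close> farey_upto_mono[of "Suc m" n] by auto
    moreover have "c < x" "x < d"
      using n mediant_between[of c d] unfolding adjacent_in_def by auto
    ultimately show False using n unfolding adjacent_in_def by blast
  qed
  obtain m where m: "m \<ge> 1" "adjacent_in (farey_upto m) a b" "x = mediant a b"
    using assms(1) unfolding farey_parents_def by blast
  obtain n where n: "n \<ge> 1" "adjacent_in (farey_upto n) c d" "x = mediant c d"
    using assms(2) unfolding farey_parents_def by blast
  have "m = n" using *[OF m n(2,3)] *[OF n m(2,3)] by simp
  then have 1: "adjacent_in (farey_upto m) c d" using n by simp
  have "a < b" "c < d" using m(2) n(2) unfolding adjacent_in_def by simp_all
  then have "a < x" "x < b" "c < x" "x < d"
    using mediant_between m(3) n(3) by metis+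
  with adjacent_in_unique[OF m(2) 1] show ?thesis by blast
qed

lemma farey_upto_bounds:
  assumes "n \<ge> 1" "x \<in> farey_upto n" shows "0 \<le> x \<and> x \<le> 1"
  using assms
proof (induction n arbitrary: x rule: dec_induct)
  case base then show ?case by (auto simp: farey_upto_1)
next
  case (step n)
  show ?case
  proof (cases "x \<in> farey_upto n")
    case True with step show ?thesis by blast
  next
    case False
    then obtain a b where ab: "adjacent_in (farey_upto n) a b" "x = mediant a b"
      using step by (auto simp: farey_upto_Suc)
    then have "a < x" "x < b" "0 \<le> a" "b \<le> 1"
      using mediant_between[of a b] step.IH unfolding adjacent_in_def by auto
    then show ?thesis by linarith
  qed
qed

lemma farey_parents_strict: "farey_parents a b x \<Longrightarrow> 0 < x \<and> x < 1"
proof -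
  assume "farey_parents a b x"
  then obtain n where n: "n \<ge> 1" "adjacent_in (farey_upto n) a b" "x = mediant a b"
    unfolding farey_parents_def by blast
  then have "a < x" "x < b" "0 \<le> a" "b \<le> 1"
    using mediant_between[of a b] farey_upto_bounds unfolding adjacent_in_def by auto
  then show ?thesis by linarith
qed

lemma num_den_mediant:
  assumes "num b * den a - num a * den b = 1"
  shows "num (mediant a b) = num a + num b" "den (mediant a b) = den a + den b"
proof -
  have "coprime (num a + num b) (den a + den b)"
  proof (rule coprimeI)
    fix c assume "c dvd num a + num b" "c dvd den a + den b"
    then have "c dvd (num a + num b) * den a - num a * (den a + den b)" by simp
    moreover have "(num a + num b) * den a - num a * (den a + den b) = 1"
      using assms by (simp add: algebra_simps)
    ultimately show "is_unit c" by simp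
  qed
  then have "quotient_of (mediant a b) = (num a + num b, den a + den b)"
    unfolding mediant_def using den_pos[of a] den_pos[of b]
    by (simp add: quotient_of_Fract normalize_stable)
  then show "num (mediant a b) = num a + num b" "den (mediant a b) = den a + den b" by simp_all
qed

lemma adjacent_in_mediant:
  assumes "n \<ge> 1" "adjacent_in (farey_upto n) a b"
  shows "adjacent_in (farey_upto (Suc n)) a (mediant a b)"
    and "adjacent_in (farey_upto (Suc n)) (mediant a b) b"
proof -
  have ab: "a < b" "a \<in> farey_upto n" "b \<in> farey_upto n"
    and no: "\<And>c. c \<in> farey_upto n \<Longrightarrow> \<not> (a < c \<and> c < b)"
    using assms(2) unfolding adjacent_in_def by auto
  have m: "a < mediant a b" "mediant a b < b" using mediant_between[OF ab(1)] by auto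
  have c: "c = mediant a b" if c: "c \<in> farey_upto (Suc n)" "a < c" "c < b" for c
  proof -
    have "c \<notin> farey_upto n" using no c by blast
    then obtain d e where de: "adjacent_in (farey_upto n) d e" "c = mediant d e"
      using c(1) assms(1) by (auto simp: farey_upto_Suc)
    then have "d < c" "c < e" using mediant_between[of d e] unfolding adjacent_in_def by auto
    then have "a = d \<and> b = e" using adjacent_in_unique[OF assms(2) de(1)] c by blast
    then show ?thesis using de by simp
  qed
  have "a \<in> farey_upto (Suc n)" "b \<in> farey_upto (Suc n)" "mediant a b \<in> farey_upto (Suc n)"
    using assms ab by (auto simp: farey_upto_Suc)
  then show "adjacent_in (farey_upto (Suc n)) a (mediant a b)"
    "adjacent_in (farey_upto (Suc n)) (mediant a b) b"
    unfolding adjacent_in_def using m c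
    by (metis less_irrefl less_trans)+
qed

lemma farey_bracket:
  assumes "n \<ge> 1" "0 < x" "x < 1" "x \<notin> farey_upto n"
  shows "\<exists>a b. adjacent_in (farey_upto n) a b \<and> a < x \<and> x < b
           \<and> num b * den a - num a * den b = 1 \<and> int n + 1 \<le> den a + den b"
  using assms
proof (induction n rule: dec_induct)
  case base
  have "adjacent_in (farey_upto (Suc 0)) 0 1"
    by (auto simp: farey_upto_1 adjacent_in_def)
  with base show ?case by (intro exI[of _ 0] exI[of _ 1]) simp
next
  case (step n)
  then have "x \<notin> farey_upto n" using farey_upto_mono[of n "Suc n"] by auto
  with step obtain a b where ab: "adjacent_in (farey_upto n) a b" "a < x" "x < b"
    and det: "num b * den a - num a * den b = 1" and sz: "int n + 1 \<le> den a + den b" by blast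
  let ?m = "mediant a b"
  note nd = num_den_mediant[OF det]
  have "?m \<in> farey_upto (Suc n)" using ab step by (auto simp: farey_upto_Suc)
  with step.prems have "x < ?m \<or> ?m < x" by (metis linorder_neqE)
  then show ?case
  proof
    assume "x < ?m"
    then show ?thesis
      using ab det sz nd den_pos[of a] adjacent_in_mediant(1)[OF _ ab(1)] step
      by (intro exI[of _ a] exI[of _ ?m]) (simp add: algebra_simps)
  next
    assume "?m < x"
    then show ?thesis
      using ab det sz nd den_pos[of b] adjacent_in_mediant(2)[OF _ ab(1)] step
      by (intro exI[of _ ?m] exI[of _ b]) (simp add: algebra_simps)
  qed
qed

lemma farey_upto_den:
  assumes "0 < x" "x < 1" shows "x \<in> farey_upto (nat (den x))"
proof (rule ccontr)
  assume "x \<notin> farey_upto (nat (den x))"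
  moreover have "nat (den x) \<ge> 1" using den_pos[of x] by linarith
  ultimately obtain a b where ab: "a < x" "x < b"
    and det: "num b * den a - num a * den b = 1" and sz: "int (nat (den x)) + 1 \<le> den a + den b"
    using farey_bracket[OF _ assms] by blast
  have "1 \<le> num x * den a - num a * den x" "1 \<le> num b * den x - num x * den b"
    using ab by (simp_all add: less_iff_num_den)
  then have "den b * 1 \<le> den b * (num x * den a - num a * den x)"
    "den a * 1 \<le> den a * (num b * den x - num x * den b)"
    using den_pos[of a] den_pos[of b] by (simp_all only: mult_le_cancel_left_pos)
  then have "den a + den b \<le> den x * (num b * den a - num a * den b)"
    by (simp add: algebra_simps)
  then show False using det sz den_pos[of x] by simp
qed

lemma farey_upto_parents:
  assumes "n \<ge> 1" "x \<in> farey_upto n" "0 < x" "x < 1"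
  obtains m a b where "m \<ge> 1" "m < n" "adjacent_in (farey_upto m) a b" "x = mediant a b"
proof -
  have "\<exists>m a b. m \<ge> 1 \<and> m < n \<and> adjacent_in (farey_upto m) a b \<and> x = mediant a b"
    using assms
  proof (induction n rule: dec_induct)
    case base then show ?case by (auto simp: farey_upto_1)
  next
    case (step n)
    show ?case
    proof (cases "x \<in> farey_upto n")
      case True with step show ?thesis by (meson less_SucI)
    next
      case False
      with step show ?thesis by (auto simp: farey_upto_Suc)
    qed
  qed
  then show ?thesis using that by blast
qed

lemma ex1_farey_parents:
  assumes "0 < x" "x < 1" shows "\<exists>!ab. farey_parents (fst ab) (snd ab) x"
proof -
  have "nat (den x) \<ge> 1" using den_pos[of x] by linarith
  from farey_upto_parents[OF this farey_upto_den[OF assms] assms]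
  obtain a b where "farey_parents a b x" unfolding farey_parents_def by metis
  then show ?thesis using farey_parents_unique
    by (intro ex1I[of _ "(a, b)"]) (auto simp: prod_eq_iff)
qed

lemma is_haros_graph_cases:
  assumes "is_haros_graph x G"
  shows "(x = 0 \<or> x = 1) \<and> G = G0 \<or>
    (\<exists>a b H H'. farey_parents a b x \<and> is_haros_graph a H \<and> is_haros_graph b H' \<and> G = haros_sum H H')"
  using assms by (rule is_haros_graph.cases) blast+

lemma not_farey_parents: "\<not> farey_parents a b 0" "\<not> farey_parents a b 1"
  using farey_parents_strict by (metis less_irrefl)+

lemma is_haros_graph_unique:
  assumes "is_haros_graph x G" "is_haros_graph x G'" shows "G = G'"
  using assms
proof (induction arbitrary: G')
  case zero then show ?case
    using is_haros_graph_cases not_farey_parents by metis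
next
  case one then show ?case
    using is_haros_graph_cases not_farey_parents by metis
next
  case (mediant a b x H H')
  have "x \<noteq> 0" "x \<noteq> 1" using mediant.hyps(1) not_farey_parents by auto
  then obtain c d K K' where K: "farey_parents c d x" "is_haros_graph c K" "is_haros_graph d K'"
    "G' = haros_sum K K'"
    using is_haros_graph_cases[OF mediant.prems] by blast
  then have "a = c" "b = d" using farey_parents_unique mediant.hyps(1) by blast+
  then have "H = K" "H' = K'" using K mediant.IH by simp_all
  then show ?case using K by simp
qed

lemma ex_is_haros_graph_upto:
  "n \<ge> 1 \<Longrightarrow> x \<in> farey_upto n \<Longrightarrow> \<exists>G. is_haros_graph x G"
proof (induction n arbitrary: x rule: less_induct)
  case (less n)
  consider "x = 0" | "x = 1" | "0 < x" "x < 1"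
    using farey_upto_bounds[OF less.prems] by force
  then show ?case
  proof cases
    case 3
    from farey_upto_parents[OF less.prems 3] obtain m a b where
      m: "m \<ge> 1" "m < n" "adjacent_in (farey_upto m) a b" "x = mediant a b" .
    then have "\<exists>G. is_haros_graph a G" "\<exists>G. is_haros_graph b G"
      using less.IH[OF m(2,1)] unfolding adjacent_in_def by auto
    moreover have "farey_parents a b x" using m unfolding farey_parents_def by blast
    ultimately show ?thesis using is_haros_graph.mediant by blast
  qed (blast intro: is_haros_graph.intros)+
qed

lemma ex1_is_haros_graph:
  assumes "0 \<le> x" "x \<le> 1" shows "\<exists>!G. is_haros_graph x G"
proof -
  have "\<exists>G. is_haros_graph x G"
  proof (cases "x = 0 \<or> x = 1")
    case True then show ?thesis by (blast intro: is_haros_graph.intros)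
  next
    case False
    then have "x \<in> farey_upto (nat (den x))" using assms farey_upto_den by simp
    moreover have "nat (den x) \<ge> 1" using den_pos[of x] by linarith
    ultimately show ?thesis using ex_is_haros_graph_upto by blast
  qed
  then show ?thesis using is_haros_graph_unique by blast
qed

lemma haros_graph_eqI: "is_haros_graph x G \<Longrightarrow> haros_graph x = G"
  unfolding haros_graph_def by (rule the_equality) (auto intro: is_haros_graph_unique)

lemma haros_graph_0: "haros_graph 0 = G0" and haros_graph_1: "haros_graph 1 = G0"
  by (simp_all add: haros_graph_eqI is_haros_graph.intros)

lemma haros_graph_mediant:
  assumes "farey_parents a b x"
  shows "haros_graph x = haros_sum (haros_graph a) (haros_graph b)"
proof -
  obtain n where "n \<ge> 1" "a \<in> farey_upto n" "b \<in> farey_upto n"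
    using assms unfolding farey_parents_def adjacent_in_def by blast
  then obtain G G' where "is_haros_graph a G" "is_haros_graph b G'"
    using ex_is_haros_graph_upto by meson
  then show ?thesis
    using is_haros_graph.mediant[OF assms] by (simp add: haros_graph_eqI)
qed

lemma reduced_entropy_ge_half:
  assumes "1 / 2 \<le> x"
  shows "reduced_entropy x = (let r = real_of_rat x in
     haros_entropy x + 2 * (1 - r) * ln (1 - r) + (2 * r - 1) * ln (2 * r - 1))"
proof (cases "x = 1 / 2")
  case True
  then have r: "real_of_rat x = 1 / 2" by (simp only: of_rat_divide of_rat_1 of_rat_numeral_eq)
  have "x \<le> 1 / 2" using True by simp
  then show ?thesis unfolding reduced_entropy_def Let_def r by simp
next
  case False
  with assms show ?thesis by (simp add: reduced_entropy_def)
qed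

end

theory Submission
  imports Defs
begin

text \<open>
  The base path of the Haros graph of \<open>p/q\<close> consists of \<open>q - p\<close> copies of the graph of \<open>0/1\<close> and \<open>p\<close>
  copies of the graph of \<open>1/1\<close>. The map \<open>F\<close> sends \<open>0\<close> to \<open>0\<close>, \<open>1\<close> to \<open>1/2\<close> and commutes with mediants,
  so it replaces every copy of \<open>1/1\<close> by a triangle: \<open>p\<close> new nodes of degree 2 appear, and every old node
  gains 1 for each adjacent copy of \<open>1/1\<close>. For \<open>0 < x < 1\<close>, nodes between copies in the order \<open>0, 1\<close> have
  degree 2, nodes between equal copies have degree 3, and all others, the boundary node included, have
  degree at least 5 (except for \<open>x = 1/2\<close>) and gain exactly 1. For \<open>x \<le> 1/2\<close> no two copies of \<open>1/1\<close> are
  consecutive, so the multiplicities of the large degrees are merely shifted; for \<open>x \<ge> 1/2\<close> no two copies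
  of \<open>0/1\<close> are consecutive, and the \<open>2p - q\<close> nodes of degree 3 become nodes of degree 5. Since
  \<open>q S = q log q - \<Sum> n log n\<close> for the multiplicities \<open>n\<close> of the degrees, the identity is a computation.
\<close>

section \<open>Pairs of Farey neighbours\<close>

text \<open>Adjacency with the level forgotten: each gap arises from an older one by cutting at its
  mediant. This gives an induction principle that never mentions levels.\<close>

inductive farey_pair :: "rat \<Rightarrow> rat \<Rightarrow> bool" where
  base: "farey_pair 0 1"
| left: "farey_pair a b \<Longrightarrow> farey_pair a (mediant a b)"
| right: "farey_pair a b \<Longrightarrow> farey_pair (mediant a b) b"

text \<open>The determinant is unchanged when one of its two columns is replaced by their
  sum.\<close>

lemma farey_pair_det: "farey_pair a b \<Longrightarrow> num b * den a - num a * den b = 1"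
  by (induction rule: farey_pair.induct) (auto simp: num_den_mediant algebra_simps)

lemma farey_pair_bounds: "farey_pair a b \<Longrightarrow> 0 \<le> a \<and> a < b \<and> b \<le> 1"
proof (induction rule: farey_pair.induct)
  case (left a b)
  then show ?case using mediant_between[of a b] by linarith
next
  case (right a b)
  then show ?case using mediant_between[of a b] by linarith
qed simp

lemma farey_pair_adjacent: "farey_pair a b \<Longrightarrow> \<exists>n\<ge>1. adjacent_in (farey_upto n) a b"
proof (induction rule: farey_pair.induct)
  case base
  have "adjacent_in (farey_upto (Suc 0)) 0 1"
    by (auto simp: farey_upto_1 adjacent_in_def)
  then show ?case by (metis One_nat_def order_refl)
qed (meson adjacent_in_mediant le_SucI)+

lemma farey_pair_parents: "farey_pair a b \<Longrightarrow> farey_parents a b (mediant a b)"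
  using farey_pair_adjacent unfolding farey_parents_def by blast

text \<open>The descent of \<open>farey_bracket\<close> again, this time recording that the gap
  around \<open>x\<close> is produced by successive cuts.\<close>

lemma farey_pair_bracket:
  assumes "n \<ge> 1" "0 < x" "x < 1" "x \<notin> farey_upto n"
  shows "\<exists>a b. adjacent_in (farey_upto n) a b \<and> a < x \<and> x < b \<and> farey_pair a b"
  using assms
proof (induction n rule: dec_induct)
  case base
  have "adjacent_in (farey_upto (Suc 0)) 0 1"
    by (auto simp: farey_upto_1 adjacent_in_def)
  with base show ?case by (intro exI[of _ 0] exI[of _ 1]) (simp add: farey_pair.base)
next
  case (step n)
  then have "x \<notin> farey_upto n" using farey_upto_mono[of n "Suc n"] by auto
  with step obtain a b where ab: "adjacent_in (farey_upto n) a b" "a < x" "x < b" "farey_pair a b"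
    by blast
  have "mediant a b \<in> farey_upto (Suc n)" using ab step by (auto simp: farey_upto_Suc)
  with step.prems have "x < mediant a b \<or> mediant a b < x" by (metis linorder_neqE)
  then show ?case
    using ab adjacent_in_mediant[OF _ ab(1)] step.hyps farey_pair.left[OF ab(4)]
      farey_pair.right[OF ab(4)] by blast
qed

text \<open>The mediant lies strictly inside the gap, hence is absent from this level. The gap found
  around it by \<open>farey_pair_bracket\<close> must be the given one.\<close>

lemma adjacent_farey_pair:
  assumes "n \<ge> 1" "adjacent_in (farey_upto n) a b"
  shows "farey_pair a b"
proof -
  have ab: "a < b" "a \<in> farey_upto n" "b \<in> farey_upto n"
    using assms(2) unfolding adjacent_in_def by auto
  let ?x = "mediant a b"
  have x: "a < ?x" "?x < b" using mediant_between[OF ab(1)] by auto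
  have "0 < ?x" "?x < 1"
    using x farey_upto_bounds[OF assms(1) ab(2)] farey_upto_bounds[OF assms(1) ab(3)] by linarith+
  moreover have "?x \<notin> farey_upto n" using assms(2) x unfolding adjacent_in_def by blast
  ultimately obtain c d where "adjacent_in (farey_upto n) c d" "c < ?x" "?x < d" "farey_pair c d"
    using farey_pair_bracket[OF assms(1)] by blast
  then show ?thesis using adjacent_in_unique[OF assms(2)] x by blast
qed

text \<open>Induction along the Farey tree. Each end of a pair is 0, 1 or the mediant of an older
  pair, so \<open>P\<close> holds at both ends of every pair, and then at each fraction through its
  parents.\<close>

lemma farey_induct [consumes 2, case_names zero one mediant]:
  assumes "0 \<le> x" "x \<le> 1" "P 0" "P 1"
    and step: "\<And>a b. farey_pair a b \<Longrightarrow> P a \<Longrightarrow> P b \<Longrightarrow> P (mediant a b)"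
  shows "P x"
proof -
  have pair: "P a \<and> P b" if "farey_pair a b" for a b
    using that by (induction rule: farey_pair.induct) (use assms in blast)+
  consider "x = 0" | "x = 1" | "0 < x" "x < 1" using assms by force
  then show ?thesis
  proof cases
    case 3
    then obtain a b where "farey_parents a b x" using ex1_farey_parents by blast
    then obtain n where "n \<ge> 1" "adjacent_in (farey_upto n) a b" "x = mediant a b"
      unfolding farey_parents_def by blast
    then show ?thesis using adjacent_farey_pair pair step by blast
  qed (use assms in auto)
qed

section \<open>The fraction 1/2 and the map F on Farey pairs\<close>

lemma mediant_0_1: "mediant 0 1 = 1 / 2"
  by (simp add: mediant_def Fract_of_int_quotient)

text \<open>The gap from 0 to 1 is first cut at 1/2, so no later gap has 1/2 in its interior. The
  two halves of the tree can therefore be treated separately.\<close>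

lemma farey_pair_half:
  "farey_pair a b \<Longrightarrow> a = 0 \<and> b = 1 \<or> b \<le> 1 / 2 \<or> 1 / 2 \<le> a"
proof (induction rule: farey_pair.induct)
  case (left a b)
  then show ?case
    using mediant_between[of a b] farey_pair_bounds[OF left.hyps] mediant_0_1 by force
next
  case (right a b)
  then show ?case
    using mediant_between[of a b] farey_pair_bounds[OF right.hyps] mediant_0_1 by force
qed simp

lemma num_nonneg: "0 \<le> x \<Longrightarrow> 0 \<le> num x"
  using less_iff_num_den[of x 0] by simp

text \<open>F sends \<open>p/q\<close> to \<open>p/(p+q)\<close>, which is reduced because gcd(p,
  p+q) = gcd(p, q).\<close>

lemma num_den_farey_F:
  assumes "0 \<le> x"
  shows "num (farey_F x) = num x" "den (farey_F x) = num x + den x"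
proof -
  have p: "0 \<le> num x" "0 < den x" using num_nonneg[OF assms] den_pos by auto
  have "coprime (num x) (den x)" by (metis prod.collapse quotient_of_coprime)
  then have "coprime (num x) (num x + den x)"
    by (metis coprime_iff_gcd_eq_1 gcd_add2)
  moreover have "farey_F x = Fract (num x) (num x + den x)"
  proof -
    have "farey_F x = (of_int (num x) / of_int (den x)) / (1 + of_int (num x) / of_int (den x))"
      unfolding farey_F_def by (simp only: rat_num_den[symmetric])
    also have "\<dots> = of_int (num x) / of_int (num x + den x)"
      using p by (simp add: field_simps)
    finally show ?thesis by (simp add: Fract_of_int_quotient)
  qed
  ultimately have "quotient_of (farey_F x) = (num x, num x + den x)"
    using p by (simp add: quotient_of_Fract normalize_stable)
  then show "num (farey_F x) = num x" "den (farey_F x) = num x + den x" by simp_all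
qed

text \<open>F is linear on the vectors (numerator, denominator), and the mediant adds these vectors.
  The determinant condition ensures that the sum is already reduced.\<close>

lemma farey_F_mediant:
  assumes "0 \<le> a" "0 \<le> b" "num b * den a - num a * den b = 1"
  shows "farey_F (mediant a b) = mediant (farey_F a) (farey_F b)"
proof -
  have d: "0 < den a" "0 < den b" "0 \<le> num a" "0 \<le> num b"
    using den_pos num_nonneg assms by auto
  then have "0 \<le> mediant a b" by (simp add: mediant_def zero_le_Fract_iff)
  then have "quotient_of (farey_F (mediant a b)) =
      (num a + num b, num a + num b + (den a + den b))"
    by (simp add: prod_eq_iff num_den_farey_F num_den_mediant[OF assms(3)])
  then have "farey_F (mediant a b) = Fract (num a + num b) (num a + num b + (den a + den b))"
    using quotient_of_div Fract_of_int_quotient by metis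
  then show ?thesis
    by (simp add: mediant_def[of "farey_F a"] num_den_farey_F assms algebra_simps)
qed

lemma farey_F_0: "farey_F 0 = 0" and farey_F_1: "farey_F 1 = 1 / 2"
  by (simp_all add: farey_F_def)

text \<open>The base pair goes to 0 and 1/2, a left cut of the base pair;
  \<open>farey_F_mediant\<close> carries every further cut along.\<close>

lemma farey_pair_farey_F: "farey_pair a b \<Longrightarrow> farey_pair (farey_F a) (farey_F b)"
proof (induction rule: farey_pair.induct)
  case base
  show ?case
    using farey_pair.left[OF farey_pair.base] by (simp add: farey_F_0 farey_F_1 mediant_0_1)
next
  case (left a b)
  then show ?case
    using farey_pair_bounds[OF left.hyps] farey_pair_det[OF left.hyps]
    by (simp add: farey_F_mediant farey_pair.left)
next
  case (right a b)
  then show ?case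
    using farey_pair_bounds[OF right.hyps] farey_pair_det[OF right.hyps]
    by (simp add: farey_F_mediant farey_pair.right)
qed

section \<open>Degrees in Haros graphs\<close>

text \<open>The invariant behind additive degree counts: edges stay in the node range, so two glued
  copies meet in one node only, and there are no loops.\<close>

definition wf_graph :: "ordered_graph \<Rightarrow> bool" where
  "wf_graph G \<longleftrightarrow> 2 \<le> fst G \<and> finite (snd G) \<and> (\<forall>e\<in>snd G. e \<subseteq> {1..fst G} \<and> card e = 2)"

lemma wf_graph_G0: "wf_graph G0"
  by (auto simp: wf_graph_def G0_def)

lemma fst_haros_sum: "fst (haros_sum G G') = fst G + fst G' - 1"
  by (simp add: haros_sum_def Let_def)

lemma wf_graph_haros_sum:
  assumes "wf_graph G" "wf_graph G'"
  shows "wf_graph (haros_sum G G')"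
proof -
  let ?f = "\<lambda>i. i + (fst G - 1)"
  have n: "2 \<le> fst G" "2 \<le> fst G'" using assms by (auto simp: wf_graph_def)
  have 1: "e \<subseteq> {1..fst G + fst G' - 1} \<and> card e = 2" if "e \<in> snd G" for e
    using assms(1) n that by (fastforce simp: wf_graph_def)
  have 2: "?f ` e \<subseteq> {1..fst G + fst G' - 1} \<and> card (?f ` e) = 2" if "e \<in> snd G'" for e
  proof -
    have e: "e \<subseteq> {1..fst G'}" "card e = 2" using assms(2) that by (auto simp: wf_graph_def)
    have "card (?f ` e) = card e" by (rule card_image) (simp add: inj_on_def)
    moreover have "?f ` e \<subseteq> {1..fst G + fst G' - 1}" using e(1) n by fastforce
    ultimately show ?thesis using e(2) by simp
  qed
  have 3: "{1, fst G + fst G' - 1} \<subseteq> {1..fst G + fst G' - 1} \<and> card {1, fst G + fst G' - 1} = 2"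
    using n by auto
  have "finite (snd G)" "finite (snd G')" using assms by (auto simp: wf_graph_def)
  moreover have "2 \<le> fst G + fst G' - 1" using n by simp
  ultimately show ?thesis
    unfolding wf_graph_def haros_sum_def Let_def using 1 2 3 by auto
qed

lemma node_degree_outside: "wf_graph G \<Longrightarrow> fst G < v \<Longrightarrow> node_degree G v = 0"
  unfolding node_degree_def wf_graph_def by (fastforce simp: card_eq_0_iff)

text \<open>The edges at \<open>v\<close> are the disjoint union of those from \<open>G\<close>,
  those from the shifted \<open>G'\<close>, and possibly the new outer edge.\<close>

lemma node_degree_haros_sum:
  assumes "wf_graph G" "wf_graph G'"
  shows "node_degree (haros_sum G G') v = node_degree G v
    + (if fst G \<le> v then node_degree G' (v - (fst G - 1)) else 0)
    + (if v = 1 \<or> v = fst G + fst G' - 1 then 1 else 0)"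
proof -
  let ?a = "fst G" and ?n = "fst G + fst G' - 1"
  let ?f = "\<lambda>i. i + (?a - 1)"
  have n: "2 \<le> ?a" "2 \<le> fst G'" "finite (snd G)" "finite (snd G')"
    and G: "\<And>e. e \<in> snd G \<Longrightarrow> e \<subseteq> {1..?a} \<and> card e = 2"
    and G': "\<And>e. e \<in> snd G' \<Longrightarrow> e \<subseteq> {1..fst G'} \<and> card e = 2"
    using assms by (auto simp: wf_graph_def)
  define A where "A = {e \<in> snd G. v \<in> e}"
  define B where "B = {e \<in> snd G'. v \<in> ?f ` e}"
  define C where "C = (if v = 1 \<or> v = ?n then {{1, ?n}} else {})"
  have "{e \<in> snd (haros_sum G G'). v \<in> e} = A \<union> (\<lambda>e. ?f ` e) ` B \<union> C"
    by (auto simp: haros_sum_def Let_def A_def B_def C_def)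
  \<comment> \<open>The two copies share only the node \<open>fst G\<close>, so a common edge would
    have a single end point.\<close>
  moreover have "A \<inter> (\<lambda>e. ?f ` e) ` B = {}"
  proof (rule ccontr)
    assume "A \<inter> (\<lambda>e. ?f ` e) ` B \<noteq> {}"
    then obtain e where e: "e \<in> snd G'" "?f ` e \<in> snd G" by (auto simp: A_def B_def)
    have "i = 1" if "i \<in> e" for i
    proof -
      have "?f i \<in> {1..?a}" using G[OF e(2)] that by blast
      then have "?f i \<le> ?a" unfolding atLeastAtMost_iff ..
      moreover have "1 \<le> i" using G'[OF e(1)] that by auto
      ultimately show ?thesis using n by linarith
    qed
    then have "e \<subseteq> {1}" by blast
    then have "card e \<le> card {1::nat}" by (intro card_mono) auto
    then show False using G'[OF e(1)] by simp
  qed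
  \<comment> \<open>The outer edge reaches beyond the last node of \<open>G\<close> and starts
    before the first node of the shifted \<open>G'\<close>.\<close>
  moreover have "(A \<union> (\<lambda>e. ?f ` e) ` B) \<inter> C = {}"
  proof -
    have "{1, ?n} \<notin> snd G" using G n by fastforce
    moreover have "{1, ?n} \<noteq> ?f ` e" if "e \<in> snd G'" for e
    proof
      assume "{1, ?n} = ?f ` e"
      then obtain i where i: "i \<in> e" "1 = ?f i" by blast
      then have "1 \<le> i" using G'[OF that] by auto
      then show False using i(2) n(1) by linarith
    qed
    ultimately show ?thesis unfolding A_def B_def C_def by auto
  qed
  moreover have "finite A" "finite B" "finite C"
    using n by (auto simp: A_def B_def C_def)
  moreover have "card ((\<lambda>e. ?f ` e) ` B) = card B"
  proof -
    have "inj ?f" by (simp add: inj_on_def)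
    then show ?thesis by (intro card_image inj_onI) (simp only: inj_image_eq_iff)
  qed
  moreover have "card B = (if ?a \<le> v then node_degree G' (v - (?a - 1)) else 0)"
  proof (cases "?a \<le> v")
    case True
    have "v \<in> ?f ` e \<longleftrightarrow> v - (?a - 1) \<in> e" for e
      using True by (auto simp: image_iff intro!: bexI[of _ "v - (?a - 1)"])
    then show ?thesis using True by (simp add: B_def node_degree_def)
  next
    case False
    then have "B = {}" using G' n by (fastforce simp: B_def)
    then show ?thesis using False by simp
  qed
  moreover have "card C = (if v = 1 \<or> v = ?n then 1 else 0)" by (simp add: C_def)
  moreover have "card A = node_degree G v" by (simp add: A_def node_degree_def)
  ultimately show ?thesis
    by (simp add: node_degree_def[of "haros_sum G G'"] card_Un_disjoint)
qed

text \<open>The end nodes are left out because their degrees still change under further gluing,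
  while an inner degree is final.\<close>

definition inner_degrees :: "ordered_graph \<Rightarrow> nat multiset" where
  "inner_degrees G = image_mset (node_degree G) (mset_set {2..<fst G})"

text \<open>The glued node is the only new inner node and unites the edges of both ends; the outer
  edge touches no inner node.\<close>

lemma inner_degrees_haros_sum:
  assumes "wf_graph G" "wf_graph G'"
  shows "inner_degrees (haros_sum G G') =
    add_mset (node_degree G (fst G) + node_degree G' 1) (inner_degrees G + inner_degrees G')"
proof -
  let ?a = "fst G" and ?b = "fst G'" and ?d = "node_degree (haros_sum G G')"
  let ?f = "\<lambda>i. i + (?a - 1)"
  have n: "2 \<le> ?a" "2 \<le> ?b" using assms by (auto simp: wf_graph_def)
  have "{2..<?a + ?b - 1} = insert ?a ({2..<?a} \<union> ?f ` {2..<?b})"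
    unfolding image_add_atLeastLessThan' using n by auto
  moreover have "?a \<notin> {2..<?a} \<union> ?f ` {2..<?b}" using n by auto
  moreover have "mset_set ({2..<?a} \<union> ?f ` {2..<?b}) = mset_set {2..<?a} + mset_set (?f ` {2..<?b})"
    unfolding image_add_atLeastLessThan' using n by (intro mset_set_Union) auto
  moreover have "mset_set (?f ` {2..<?b}) = image_mset ?f (mset_set {2..<?b})"
    by (rule image_mset_mset_set[symmetric]) (simp add: inj_on_def)
  moreover have "image_mset ?d (mset_set {2..<?a}) = inner_degrees G"
    unfolding inner_degrees_def
    using n by (intro image_mset_cong) (auto simp: node_degree_haros_sum[OF assms])
  \<comment> \<open>These nodes lie beyond \<open>fst G\<close>, where \<open>G\<close> contributes
    degree 0.\<close>
  moreover have "image_mset ?d (image_mset ?f (mset_set {2..<?b})) = inner_degrees G'"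
    unfolding inner_degrees_def multiset.map_comp
    using n by (intro image_mset_cong)
      (auto simp: node_degree_haros_sum[OF assms] node_degree_outside[OF assms(1)])
  moreover have "?d ?a = node_degree G ?a + node_degree G' 1"
    using n by (auto simp: node_degree_haros_sum[OF assms])
  ultimately show ?thesis
    by (simp add: inner_degrees_def[of "haros_sum G G'"] fst_haros_sum)
qed

section \<open>Degree recursion along the Farey tree\<close>

abbreviation first_degree :: "rat \<Rightarrow> nat" where
  "first_degree x \<equiv> node_degree (haros_graph x) 1"

abbreviation last_degree :: "rat \<Rightarrow> nat" where
  "last_degree x \<equiv> node_degree (haros_graph x) (fst (haros_graph x))"

abbreviation haros_inner :: "rat \<Rightarrow> nat multiset" where
  "haros_inner x \<equiv> inner_degrees (haros_graph x)"

lemma haros_graph_pair: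
  "farey_pair a b \<Longrightarrow> haros_graph (mediant a b) = haros_sum (haros_graph a) (haros_graph b)"
  using haros_graph_mediant[OF farey_pair_parents] .

lemma wf_haros_graph: "0 \<le> x \<Longrightarrow> x \<le> 1 \<Longrightarrow> wf_graph (haros_graph x)"
  by (induction rule: farey_induct)
    (simp_all add: haros_graph_0 haros_graph_1 wf_graph_G0 haros_graph_pair wf_graph_haros_sum)

lemma wf_haros_graph_pair:
  assumes "farey_pair a b"
  shows "wf_graph (haros_graph a)" "wf_graph (haros_graph b)"
  using farey_pair_bounds[OF assms] by (auto intro: wf_haros_graph)

lemma haros_graph_order: "0 \<le> x \<Longrightarrow> x \<le> 1 \<Longrightarrow> fst (haros_graph x) = nat (den x) + 1"
proof (induction rule: farey_induct)
  case (mediant a b)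
  then show ?case
    using num_den_mediant(2)[OF farey_pair_det] den_pos[of a] den_pos[of b]
    by (simp add: haros_graph_pair fst_haros_sum nat_add_distrib)
qed (simp_all add: haros_graph_0 haros_graph_1 G0_def)

text \<open>The recursion on which all later degree facts rest. The \<open>Suc\<close> at either end
  is the outer edge.\<close>

lemma degrees_mediant:
  assumes "farey_pair a b"
  shows "first_degree (mediant a b) = Suc (first_degree a)"
    and "last_degree (mediant a b) = Suc (last_degree b)"
    and "haros_inner (mediant a b) =
      add_mset (last_degree a + first_degree b) (haros_inner a + haros_inner b)"
proof -
  note wf = wf_haros_graph_pair[OF assms]
  have n: "2 \<le> fst (haros_graph a)" "2 \<le> fst (haros_graph b)" using wf by (auto simp: wf_graph_def)
  show "first_degree (mediant a b) = Suc (first_degree a)"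
    using n by (simp add: haros_graph_pair[OF assms] node_degree_haros_sum[OF wf])
  show "last_degree (mediant a b) = Suc (last_degree b)"
    using n by (simp add: haros_graph_pair[OF assms] node_degree_haros_sum[OF wf] fst_haros_sum
        node_degree_outside[OF wf(1)])
  show "haros_inner (mediant a b) =
      add_mset (last_degree a + first_degree b) (haros_inner a + haros_inner b)"
    by (simp add: haros_graph_pair[OF assms] inner_degrees_haros_sum[OF wf])
qed

lemma degrees_G0:
  "node_degree G0 (Suc 0) = 1" "node_degree G0 2 = 1" "fst G0 = 2" "inner_degrees G0 = {#}"
proof -
  have "{e \<in> snd G0. Suc 0 \<in> e} = {{1, 2}}" "{e \<in> snd G0. 2 \<in> e} = {{1, 2}}"
    by (auto simp: G0_def)
  then show "node_degree G0 (Suc 0) = 1" "node_degree G0 2 = 1" by (simp_all add: node_degree_def)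
  show "fst G0 = 2" "inner_degrees G0 = {#}" by (simp_all add: G0_def inner_degrees_def)
qed

section \<open>Degrees of the end nodes\<close>

lemma degrees_half:
  "first_degree (1 / 2) = 2" "last_degree (1 / 2) = 2" "haros_inner (1 / 2) = {#2#}"
  using degrees_mediant[OF farey_pair.base, unfolded mediant_0_1]
  by (simp_all add: haros_graph_0 haros_graph_1 degrees_G0)

lemma mediant_interior:
  assumes "farey_pair a b" shows "0 < mediant a b" "mediant a b < 1" "a < mediant a b" "mediant a b < b"
  using mediant_between[of a b] farey_pair_bounds[OF assms] by auto

text \<open>Such a \<open>b\<close> is itself a mediant with left parent 0: one edge comes from
  \<open>G0\<close>, the other is the outer edge.\<close>

lemma first_degree_right_of_0: "farey_pair a b \<Longrightarrow> a = 0 \<Longrightarrow> b \<noteq> 1 \<Longrightarrow> first_degree b = 2"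
proof (induction rule: farey_pair.induct)
  case (left a b)
  then show ?case by (simp add: degrees_mediant[unfolded One_nat_def] haros_graph_0 degrees_G0)
next
  case (right a b)
  then show ?case using mediant_interior[OF right.hyps] by simp
qed simp

lemma last_degree_left_of_1: "farey_pair a b \<Longrightarrow> b = 1 \<Longrightarrow> a \<noteq> 0 \<Longrightarrow> last_degree a = 2"
proof (induction rule: farey_pair.induct)
  case (left a b)
  then show ?case using mediant_interior[OF left.hyps] by simp
next
  case (right a b)
  then show ?case by (simp add: degrees_mediant haros_graph_1 degrees_G0)
qed simp

lemma end_degrees_pos: "0 \<le> x \<Longrightarrow> x \<le> 1 \<Longrightarrow> 1 \<le> first_degree x \<and> 1 \<le> last_degree x"
  by (induction rule: farey_induct)
    (simp_all add: haros_graph_0 haros_graph_1 degrees_G0 degrees_mediant[unfolded One_nat_def])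

lemma end_degrees_ge_2:
  assumes "0 < x" "x < 1" shows "2 \<le> first_degree x \<and> 2 \<le> last_degree x"
proof -
  have "0 \<le> x" "x \<le> 1" using assms by auto
  then have "0 < x \<and> x < 1 \<longrightarrow> 2 \<le> first_degree x \<and> 2 \<le> last_degree x"
  proof (induction rule: farey_induct)
    case (mediant a b)
    then show ?case
      using farey_pair_bounds[of a b] end_degrees_pos[of a] end_degrees_pos[of b]
      by (simp add: degrees_mediant[unfolded One_nat_def])
  qed auto
  then show ?thesis using assms by blast
qed

text \<open>The right parent lies in (0, 1/2], so its last degree is at least 2, and the outer edge
  adds one. This pushes glued nodes to degree 5 or more.\<close>

lemma last_degree_ge_3:
  assumes "0 < x" "x < 1 / 2" shows "3 \<le> last_degree x"
proof -
  have "0 \<le> x" "x \<le> 1" using assms by auto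
  then have "0 < x \<and> x < 1 / 2 \<longrightarrow> 3 \<le> last_degree x"
  proof (induction rule: farey_induct)
    case (mediant a b)
    show ?case
    proof
      assume "0 < mediant a b \<and> mediant a b < 1 / 2"
      then have "b \<le> 1 / 2"
        using farey_pair_half[OF mediant.hyps] mediant_interior[OF mediant.hyps] mediant_0_1 by auto
      then have "2 \<le> last_degree b"
        using end_degrees_ge_2[of b] mediant_interior[OF mediant.hyps] by simp
      then show "3 \<le> last_degree (mediant a b)" by (simp add: degrees_mediant mediant.hyps)
    qed
  qed auto
  then show ?thesis using assms by blast
qed

lemma first_degree_ge_3:
  assumes "1 / 2 < x" "x < 1" shows "3 \<le> first_degree x"
proof -
  have "0 \<le> x" "x \<le> 1" using assms by auto
  then have "1 / 2 < x \<and> x < 1 \<longrightarrow> 3 \<le> first_degree x"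
  proof (induction rule: farey_induct)
    case (mediant a b)
    show ?case
    proof
      assume "1 / 2 < mediant a b \<and> mediant a b < 1"
      then have "1 / 2 \<le> a"
        using farey_pair_half[OF mediant.hyps] mediant_interior[OF mediant.hyps] mediant_0_1 by auto
      then have "2 \<le> first_degree a"
        using end_degrees_ge_2[of a] mediant_interior[OF mediant.hyps] by simp
      then show "3 \<le> first_degree (mediant a b)"
        by (simp add: degrees_mediant[unfolded One_nat_def] mediant.hyps)
    qed
  qed auto
  then show ?thesis using assms by blast
qed

text \<open>An end node gains an edge exactly when the outermost copy on its side is one of 1/1. At
  the left end this happens only for \<open>x = 1\<close>, at the right end for every
  \<open>x\<close> except 0.\<close>

lemma end_degrees_farey_F:
  "0 \<le> x \<Longrightarrow> x \<le> 1 \<Longrightarrow>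
    first_degree (farey_F x) = first_degree x + (if x = 1 then 1 else 0) \<and>
    last_degree (farey_F x) = last_degree x + (if x = 0 then 0 else 1)"
proof (induction rule: farey_induct)
  case zero
  show ?case by (simp add: farey_F_0)
next
  case one
  show ?case
    using degrees_half by (simp add: farey_F_1 haros_graph_1 degrees_G0)
next
  case (mediant a b)
  have F: "farey_F (mediant a b) = mediant (farey_F a) (farey_F b)"
    using farey_F_mediant farey_pair_bounds[OF mediant.hyps] farey_pair_det[OF mediant.hyps] by auto
  show ?case
    using mediant mediant_interior[OF mediant.hyps] farey_pair_bounds[OF mediant.hyps]
      degrees_mediant[OF mediant.hyps] degrees_mediant[OF farey_pair_farey_F[OF mediant.hyps]]
    by (simp add: F)
qed

text \<open>The two conditionals count the copies of 1/1 next to the glued node, on its left and on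
  its right.\<close>

lemma haros_inner_farey_F_mediant:
  assumes "farey_pair a b"
  shows "haros_inner (farey_F (mediant a b)) =
    add_mset (last_degree a + first_degree b + (if a = 0 then 0 else 1) + (if b = 1 then 1 else 0))
      (haros_inner (farey_F a) + haros_inner (farey_F b))"
proof -
  have F: "farey_F (mediant a b) = mediant (farey_F a) (farey_F b)"
    using farey_F_mediant farey_pair_bounds[OF assms] farey_pair_det[OF assms] by auto
  have "0 \<le> a" "a \<le> 1" "0 \<le> b" "b \<le> 1" using farey_pair_bounds[OF assms] by auto
  then show ?thesis
    using degrees_mediant(3)[OF farey_pair_farey_F[OF assms]] end_degrees_farey_F[of a]
      end_degrees_farey_F[of b]
    by (simp add: F)
qed


section \<open>Multiplicities of the inner degrees in each half\<close>

lemma num_den_half: "num (1 / 2) = 1" "den (1 / 2) = 2"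
  using num_den_mediant[of 1 0] by (simp_all add: mediant_0_1)

lemma two_num_le_den: "x \<le> 1 / 2 \<Longrightarrow> 2 * num x \<le> den x"
  using less_iff_num_den[of "1 / 2" x] unfolding num_den_half by linarith

lemma den_le_two_num: "1 / 2 \<le> x \<Longrightarrow> den x \<le> 2 * num x"
  using less_iff_num_den[of x "1 / 2"] unfolding num_den_half by linarith

lemma num_less_den: "x < 1 \<Longrightarrow> num x < den x"
  using less_iff_num_den[of x 1] by simp

lemma haros_inner_half_F: "haros_inner (farey_F (1 / 2)) = {#2, 3#}"
  using haros_inner_farey_F_mediant[OF farey_pair.base] degrees_half(3)
  by (simp add: mediant_0_1 farey_F_0 farey_F_1 haros_graph_0 haros_graph_1 degrees_G0)

lemma replicate_mset_plus: "replicate_mset (m + n) k = replicate_mset m k + replicate_mset n k"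
  by (induction m) simp_all

text \<open>Each of the \<open>p\<close> copies of 1/1 follows a copy of 0/1, giving
  \<open>p\<close> nodes of degree 2; F turns them into degree 3 and adds \<open>p\<close> new nodes
  of degree 2. The \<open>q - 2p\<close> nodes between copies of 0/1 keep degree 3, and
  \<open>E\<close> collects the rest. The value 0 is excluded: \<open>q - 2p = 1\<close> there, but
  no inner node exists.\<close>

lemma haros_inner_left_half:
  assumes "0 < x" "x \<le> 1 / 2"
  shows "\<exists>E. (\<forall>e\<in>#E. 5 \<le> e) \<and>
    haros_inner x = replicate_mset (nat (num x)) 2 + replicate_mset (nat (den x - 2 * num x)) 3 + E \<and>
    haros_inner (farey_F x) = replicate_mset (nat (num x)) 2
      + replicate_mset (nat (den x - num x)) 3 + image_mset Suc E" (is "?P x")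
proof -
  have "0 \<le> x" "x \<le> 1" using assms by auto
  then have "0 < x \<and> x \<le> 1 / 2 \<longrightarrow> ?P x"
  proof (induction rule: farey_induct)
    case (mediant a b)
    note pair = mediant.hyps
    note nd = num_den_mediant[OF farey_pair_det[OF pair]]
    note D = degrees_mediant(3)[OF pair] haros_inner_farey_F_mediant[OF pair]
    show ?case
    proof
      assume "0 < mediant a b \<and> mediant a b \<le> 1 / 2"
      \<comment> \<open>A graph ends with a copy of 1/1 unless its fraction is 0, and starts with a
        copy of 0/1 unless its fraction is 1. The cases are thus the orders 01, 00 and 10 at the
        glued node.\<close>
      then consider "a = 0" "b = 1" | "a = 0" "b \<le> 1 / 2" | "0 < a" "b \<le> 1 / 2"
        using farey_pair_half[OF pair] farey_pair_bounds[OF pair] mediant_interior[OF pair] by force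
      then show "?P (mediant a b)"
      proof cases
        case 1
        then show ?thesis
          using degrees_half(3) haros_inner_half_F num_den_half by (simp add: mediant_0_1)
      next
        case 2
        have b: "0 < b" "b \<noteq> 1" using 2 farey_pair_bounds[OF pair] by auto
        with mediant.IH(2) 2 obtain E where E: "\<forall>e\<in>#E. 5 \<le> e"
          "haros_inner b = replicate_mset (nat (num b)) 2 + replicate_mset (nat (den b - 2 * num b)) 3 + E"
          "haros_inner (farey_F b) = replicate_mset (nat (num b)) 2
            + replicate_mset (nat (den b - num b)) 3 + image_mset Suc E" by blast
        \<comment> \<open>The glued node has degree 1 + 2 = 3, unchanged by F; it accounts for the
          summand 1 that 0/1 adds to the number of nodes of degree 3.\<close>
        have "first_degree b = 2" using first_degree_right_of_0[OF pair] 2 b by simp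
        moreover have "nat (1 + den b - 2 * num b) = Suc (nat (den b - 2 * num b))"
          "nat (1 + den b - num b) = Suc (nat (den b - num b))"
          using two_num_le_den[OF 2(2)] num_nonneg[of b] b by simp_all
        ultimately show ?thesis
          unfolding D nd E using 2 b E(1)
          by (intro exI[of _ E]) (simp add: haros_graph_0 degrees_G0 farey_F_0)
      next
        case 3
        have ab: "a < 1 / 2" "0 < b" "b \<noteq> 1" "a \<noteq> 0" "a \<le> 1 / 2" "b < 1"
          using 3 farey_pair_bounds[OF pair] by auto
        with mediant.IH(1) 3 obtain E where E: "\<forall>e\<in>#E. 5 \<le> e"
          "haros_inner a = replicate_mset (nat (num a)) 2 + replicate_mset (nat (den a - 2 * num a)) 3 + E"
          "haros_inner (farey_F a) = replicate_mset (nat (num a)) 2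
            + replicate_mset (nat (den a - num a)) 3 + image_mset Suc E" by blast
        from ab mediant.IH(2) 3 obtain E' where E': "\<forall>e\<in>#E'. 5 \<le> e"
          "haros_inner b = replicate_mset (nat (num b)) 2 + replicate_mset (nat (den b - 2 * num b)) 3 + E'"
          "haros_inner (farey_F b) = replicate_mset (nat (num b)) 2
            + replicate_mset (nat (den b - num b)) 3 + image_mset Suc E'" by blast
        \<comment> \<open>The glued node has degree at least 3 + 2 and gains one under F, so it
          joins \<open>E\<close>.\<close>
        have "5 \<le> last_degree a + first_degree b"
          using last_degree_ge_3[of a] end_degrees_ge_2[of b] 3 ab by simp
        moreover have "nat (num a + num b) = nat (num a) + nat (num b)"
          "nat (den a + den b - 2 * (num a + num b)) = nat (den a - 2 * num a) + nat (den b - 2 * num b)"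
          "nat (den a + den b - (num a + num b)) = nat (den a - num a) + nat (den b - num b)"
          using two_num_le_den[OF 3(2)] two_num_le_den[OF ab(5)] 3 ab num_nonneg[of a] num_nonneg[of b]
          by simp_all
        ultimately show ?thesis
          unfolding D nd E E' using ab E(1) E'(1)
          by (intro exI[of _ "add_mset (last_degree a + first_degree b) (E + E')"])
            (auto simp: replicate_mset_plus)
      qed
    qed
  qed auto
  then show ?thesis using assms by blast
qed

text \<open>Here no two copies of 0/1 are consecutive. The \<open>q - p\<close> nodes of order 01 go
  from degree 2 to 3; the \<open>2p - q\<close> nodes between copies of 1/1 gain on both sides and
  go from 3 to 5.\<close>

lemma haros_inner_right_half:
  assumes "1 / 2 \<le> x" "x < 1"
  shows "\<exists>E. (\<forall>e\<in>#E. 5 \<le> e) \<and>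
    haros_inner x = replicate_mset (nat (den x - num x)) 2
      + replicate_mset (nat (2 * num x - den x)) 3 + E \<and>
    haros_inner (farey_F x) = replicate_mset (nat (num x)) 2
      + replicate_mset (nat (den x - num x)) 3 + replicate_mset (nat (2 * num x - den x)) 5
      + image_mset Suc E" (is "?P x")
proof -
  have "0 \<le> x" "x \<le> 1" using assms by auto
  then have "1 / 2 \<le> x \<and> x < 1 \<longrightarrow> ?P x"
  proof (induction rule: farey_induct)
    case (mediant a b)
    note pair = mediant.hyps
    note nd = num_den_mediant[OF farey_pair_det[OF pair]]
    note D = degrees_mediant(3)[OF pair] haros_inner_farey_F_mediant[OF pair]
    show ?case
    proof
      assume "1 / 2 \<le> mediant a b \<and> mediant a b < 1"
      then consider "a = 0" "b = 1" | "1 / 2 \<le> a" "b = 1" | "1 / 2 \<le> a" "b < 1"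
        using farey_pair_half[OF pair] farey_pair_bounds[OF pair] mediant_interior[OF pair] by force
      then show "?P (mediant a b)"
      proof cases
        case 1
        then show ?thesis
          using degrees_half(3) haros_inner_half_F num_den_half by (simp add: mediant_0_1)
      next
        case 2
        have a: "a < 1" "a \<noteq> 0" using 2 farey_pair_bounds[OF pair] by auto
        with mediant.IH(1) 2 obtain E where E: "\<forall>e\<in>#E. 5 \<le> e"
          "haros_inner a = replicate_mset (nat (den a - num a)) 2
            + replicate_mset (nat (2 * num a - den a)) 3 + E"
          "haros_inner (farey_F a) = replicate_mset (nat (num a)) 2
            + replicate_mset (nat (den a - num a)) 3 + replicate_mset (nat (2 * num a - den a)) 5
            + image_mset Suc E" by blast
        \<comment> \<open>The glued node has degree 2 + 1 = 3 and becomes 5. The new node of degree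
          2 comes from the triangle \<open>farey_F 1 = 1/2\<close>.\<close>
        have "last_degree a = 2" using last_degree_left_of_1[OF pair] 2 a by simp
        moreover have "nat (num a + 1) = Suc (nat (num a))"
          "nat (den a + 1 - (num a + 1)) = nat (den a - num a)"
          "nat (2 * (num a + 1) - (den a + 1)) = Suc (nat (2 * num a - den a))"
          using den_le_two_num[OF 2(1)] den_pos[of a] by simp_all
        ultimately show ?thesis
          unfolding D nd E using 2 a E(1) degrees_half(3)
          by (intro exI[of _ E]) (simp add: haros_graph_1 degrees_G0 farey_F_1)
      next
        case 3
        have ab: "0 < a" "b \<noteq> 1" "a \<noteq> 0" "a < 1" "1 / 2 < b" "1 / 2 \<le> b"
          using 3 farey_pair_bounds[OF pair] by auto
        with mediant.IH(1) 3 obtain E where E: "\<forall>e\<in>#E. 5 \<le> e"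
          "haros_inner a = replicate_mset (nat (den a - num a)) 2
            + replicate_mset (nat (2 * num a - den a)) 3 + E"
          "haros_inner (farey_F a) = replicate_mset (nat (num a)) 2
            + replicate_mset (nat (den a - num a)) 3 + replicate_mset (nat (2 * num a - den a)) 5
            + image_mset Suc E" by blast
        from ab mediant.IH(2) 3 obtain E' where E': "\<forall>e\<in>#E'. 5 \<le> e"
          "haros_inner b = replicate_mset (nat (den b - num b)) 2
            + replicate_mset (nat (2 * num b - den b)) 3 + E'"
          "haros_inner (farey_F b) = replicate_mset (nat (num b)) 2
            + replicate_mset (nat (den b - num b)) 3 + replicate_mset (nat (2 * num b - den b)) 5
            + image_mset Suc E'" by blast
        have "5 \<le> last_degree a + first_degree b"
          using first_degree_ge_3[of b] end_degrees_ge_2[of a] 3 ab by simp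
        moreover have "nat (num a + num b) = nat (num a) + nat (num b)"
          "nat (2 * (num a + num b) - (den a + den b)) = nat (2 * num a - den a) + nat (2 * num b - den b)"
          "nat (den a + den b - (num a + num b)) = nat (den a - num a) + nat (den b - num b)"
          using den_le_two_num[OF 3(1)] den_le_two_num[OF ab(6)] 3 ab num_nonneg[of a] num_nonneg[of b]
            num_less_den[of a] num_less_den[of b] by simp_all
        ultimately show ?thesis
          unfolding D nd E E' using ab E(1) E'(1)
          by (intro exI[of _ "add_mset (last_degree a + first_degree b) (E + E')"])
            (auto simp: replicate_mset_plus)
      qed
    qed
  qed auto
  then show ?thesis using assms by blast
qed

section \<open>Entropy\<close>

text \<open>The degrees after merging the two end nodes into the boundary node, one for each of the
  \<open>q\<close> remaining nodes.\<close>

definition closed_degrees :: "rat \<Rightarrow> nat multiset" where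
  "closed_degrees x = add_mset (first_degree x + last_degree x) (haros_inner x)"

lemma closed_degrees_altdef:
  assumes "0 \<le> x" "x \<le> 1"
  shows "closed_degrees x =
    image_mset (bdegree (haros_graph x)) (mset_set {1..fst (haros_graph x) - 1})"
proof -
  let ?n = "fst (haros_graph x)"
  have "2 \<le> ?n" using wf_haros_graph[OF assms] by (simp add: wf_graph_def)
  then have "{1..?n - 1} = insert 1 {2..<?n}" by auto
  moreover have "image_mset (bdegree (haros_graph x)) (mset_set {2..<?n}) = haros_inner x"
    unfolding inner_degrees_def by (intro image_mset_cong) (simp add: bdegree_def)
  ultimately show ?thesis by (simp add: closed_degrees_def bdegree_def)
qed

lemma degree_dist_count:
  assumes "0 \<le> x" "x \<le> 1"
  shows "degree_dist k x = count (closed_degrees x) k / of_int (den x)"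
  using den_pos[of x] haros_graph_order[OF assms]
  by (simp add: degree_dist_def closed_degrees_altdef[OF assms] count_image_mset_eq_card_vimage)

lemma size_closed_degrees:
  assumes "0 \<le> x" "x \<le> 1"
  shows "size (closed_degrees x) = nat (den x)"
  using haros_graph_order[OF assms] by (simp add: closed_degrees_altdef[OF assms])

text \<open>The sum of n log n over the multiplicities n. It ignores the values of the degrees, so
  shifting all large degrees by one leaves it unchanged.\<close>

definition log_sum :: "'a multiset \<Rightarrow> real" where
  "log_sum M = (\<Sum>k\<in>set_mset M. real (count M k) * ln (real (count M k)))"

lemma log_sum_plus:
  assumes "set_mset M \<inter> set_mset N = {}"
  shows "log_sum (M + N) = log_sum M + log_sum N"
proof -
  have "count N k = 0" if "k \<in># M" for k using that assms by (auto simp: count_eq_zero_iff)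
  moreover have "count M k = 0" if "k \<in># N" for k using that assms by (auto simp: count_eq_zero_iff)
  ultimately show ?thesis
    by (simp add: log_sum_def sum.union_disjoint assms)
qed

lemma log_sum_replicate: "log_sum (replicate_mset n k) = real n * ln (real n)"
  by (simp add: log_sum_def)

lemma log_sum_image:
  assumes "inj f" shows "log_sum (image_mset f M) = log_sum M"
proof -
  have "count (image_mset f M) (f k) = count M k" for k
    using assms by (induction M) (auto simp: inj_eq)
  then show ?thesis
    using assms by (simp add: log_sum_def sum.reindex inj_on_subset)
qed

lemma mult_ln_divide:
  fixes p q :: real
  assumes "0 \<le> p" "0 < q"
  shows "p * ln (p / q) = p * ln p - p * ln q"
  using assms by (cases "p = 0") (simp_all add: ln_div algebra_simps)

text \<open>Expanding log(n/q) = log n - log q, where the multiplicities n sum to \<open>q\<close>.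
  The bound 2 puts every degree into the range of the defining sum.\<close>

lemma den_haros_entropy:
  assumes "0 \<le> x" "x \<le> 1" "\<forall>k\<in>#closed_degrees x. 2 \<le> k"
  shows "of_int (den x) * haros_entropy x =
    of_int (den x) * ln (of_int (den x)) - log_sum (closed_degrees x)"
proof -
  let ?M = "closed_degrees x" and ?q = "real_of_int (den x)"
  have q: "?q > 0" using den_pos by simp
  \<comment> \<open>Terms of multiplicity 0 vanish, so the infinite sum shrinks to the finite
    support.\<close>
  have "haros_entropy x = - (\<Sum>\<^sub>\<infinity>k\<in>set_mset ?M. degree_dist k x * ln (degree_dist k x))"
    unfolding haros_entropy_def
    using assms(3) by (intro arg_cong[of _ _ uminus] infsum_cong_neutral)
      (auto simp: degree_dist_count[OF assms(1,2)] count_eq_zero_iff)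
  also have "\<dots> = - (\<Sum>k\<in>set_mset ?M. degree_dist k x * ln (degree_dist k x))" by simp
  finally have "?q * haros_entropy x =
      - (\<Sum>k\<in>set_mset ?M. real (count ?M k) * ln (real (count ?M k) / ?q))"
    using q by (simp add: sum_distrib_left degree_dist_count[OF assms(1,2)])
  also have "\<dots> = (\<Sum>k\<in>set_mset ?M. real (count ?M k)) * ln ?q - log_sum ?M"
    using q by (simp add: mult_ln_divide log_sum_def sum_subtractf sum_distrib_right)
  also have "(\<Sum>k\<in>set_mset ?M. real (count ?M k)) = ?q"
  proof -
    have "(\<Sum>k\<in>set_mset ?M. real (count ?M k)) = real (size ?M)"
      by (simp add: size_multiset_overloaded_eq)
    then show ?thesis using size_closed_degrees[OF assms(1,2)] q by simp
  qed
  finally show ?thesis .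
qed

section \<open>Reduced entropy multiplied by the denominator\<close>

lemma of_rat_num_den: "real_of_rat x = of_int (num x) / of_int (den x)"
  using rat_num_den[of x] by (metis of_rat_divide of_rat_of_int_eq)

text \<open>The correction terms have weights 2p and q - 2p, which sum to \<open>q\<close>. The
  resulting - q log q cancels the one in \<open>den_haros_entropy\<close>.\<close>

lemma den_reduced_entropy_left:
  assumes "0 \<le> x" "x \<le> 1 / 2" and p: "p = real_of_int (num x)" and q: "q = real_of_int (den x)"
  shows "q * reduced_entropy x =
    q * haros_entropy x + 2 * (p * ln p) + (q - 2 * p) * ln (q - 2 * p) - q * ln q"
proof -
  have pq: "0 \<le> p" "0 < q" "0 \<le> q - 2 * p"
    using assms two_num_le_den[OF assms(2)] num_nonneg[of x] den_pos[of x] by simp_all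
  have r: "real_of_rat x = p / q" "1 - 2 * (p / q) = (q - 2 * p) / q"
    using pq by (simp_all add: of_rat_num_den p q field_simps)
  have "q * reduced_entropy x =
      q * haros_entropy x + 2 * (p * ln (p / q)) + (q - 2 * p) * ln ((q - 2 * p) / q)"
  proof -
    have "q * (A + 2 * (p / q) * B + (q - 2 * p) / q * C) = q * A + 2 * (p * B) + (q - 2 * p) * C"
      for A B C using pq by (simp add: field_simps)
    then show ?thesis unfolding reduced_entropy_def Let_def r using assms(2) by simp
  qed
  then show ?thesis
    unfolding mult_ln_divide[OF pq(1,2)] mult_ln_divide[OF pq(3,2)] by (simp add: algebra_simps)
qed

lemma den_reduced_entropy_right:
  assumes "1 / 2 \<le> x" "x \<le> 1" and p: "p = real_of_int (num x)" and q: "q = real_of_int (den x)"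
  shows "q * reduced_entropy x =
    q * haros_entropy x + 2 * ((q - p) * ln (q - p)) + (2 * p - q) * ln (2 * p - q) - q * ln q"
proof -
  have "num x \<le> den x" using less_iff_num_den[of 1 x] assms(2) by simp
  then have pq: "0 \<le> q - p" "0 < q" "0 \<le> 2 * p - q"
    using den_le_two_num[OF assms(1)] den_pos[of x] by (simp_all add: p q)
  have r: "real_of_rat x = p / q" "2 * (p / q) - 1 = (2 * p - q) / q" "1 - p / q = (q - p) / q"
    using pq by (simp_all add: of_rat_num_den p q field_simps)
  have "q * reduced_entropy x =
      q * haros_entropy x + 2 * ((q - p) * ln ((q - p) / q)) + (2 * p - q) * ln ((2 * p - q) / q)"
  proof -
    have "q * (A + 2 * ((q - p) / q) * B + (2 * p - q) / q * C) =
        q * A + 2 * ((q - p) * B) + (2 * p - q) * C"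
      for A B C using pq by (simp add: field_simps)
    then show ?thesis unfolding reduced_entropy_ge_half[OF assms(1)] Let_def r by simp
  qed
  then show ?thesis
    unfolding mult_ln_divide[OF pq(1,2)] mult_ln_divide[OF pq(3,2)] by (simp add: algebra_simps)
qed

text \<open>The image lies in the left half, so the first branch of the reduced entropy always
  applies to it.\<close>

lemma farey_F_bounds:
  assumes "0 \<le> x" "x \<le> 1" shows "0 \<le> farey_F x" "farey_F x \<le> 1 / 2"
  using assms by (simp_all add: farey_F_def field_simps)

text \<open>The factor 1 + x is the ratio of the denominators of F(x) and x.\<close>

lemma farey_F_scaling:
  assumes "0 \<le> x" and p: "p = real_of_int (num x)" and q: "q = real_of_int (den x)"
  shows "q * ((1 + real_of_rat x) * reduced_entropy (farey_F x)) = (p + q) * reduced_entropy (farey_F x)"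
  using den_pos[of x] by (simp add: of_rat_num_den p q field_simps)

text \<open>After multiplication by \<open>q\<close>, both sides equal p log p minus the
  \<open>log_sum\<close> of the large degrees.\<close>

lemma reduced_entropy_farey_F_left:
  assumes "0 < x" "x \<le> 1 / 2"
  shows "reduced_entropy x = (1 + real_of_rat x) * reduced_entropy (farey_F x)"
proof -
  define p q where pq: "p = real_of_int (num x)" "q = real_of_int (den x)"
  have x: "0 \<le> x" "x \<le> 1" "x < 1" "x \<noteq> 0" "x \<noteq> 1" using assms by auto
  note F = farey_F_bounds[OF x(1,2)]
  have F1: "farey_F x \<le> 1" using F by simp
  have ge: "0 \<le> num x" "0 < den x" "2 * num x \<le> den x"
    using assms two_num_le_den[OF assms(2)] num_nonneg[of x] den_pos[of x] by simp_all
  have pqF: "p = real_of_int (num (farey_F x))" "p + q = real_of_int (den (farey_F x))"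
    using x by (simp_all add: pq num_den_farey_F)
  obtain E where E: "\<forall>e\<in>#E. 5 \<le> e"
    "haros_inner x = replicate_mset (nat (num x)) 2 + replicate_mset (nat (den x - 2 * num x)) 3 + E"
    "haros_inner (farey_F x) = replicate_mset (nat (num x)) 2
       + replicate_mset (nat (den x - num x)) 3 + image_mset Suc E"
    using haros_inner_left_half[OF assms] by blast
  define E' where "E' = add_mset (first_degree x + last_degree x) E"
  \<comment> \<open>The boundary node has degree 4 at \<open>x = 1/2\<close>; this bound still keeps
    it apart from 2 and 3, before and after the shift.\<close>
  have E': "\<forall>e\<in>#E'. 4 \<le> e"
    using E(1) end_degrees_ge_2[OF assms(1) x(3)] by (auto simp: E'_def)
  then have E2: "\<forall>e\<in>#E'. 2 \<le> e" by force
  have C: "closed_degrees x =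
      replicate_mset (nat (num x)) 2 + replicate_mset (nat (den x - 2 * num x)) 3 + E'"
    by (simp add: closed_degrees_def E E'_def)
  \<comment> \<open>For 0 < x < 1 the boundary node gains exactly one, at its last end, so it shifts
    together with \<open>E\<close>.\<close>
  have CF: "closed_degrees (farey_F x) = replicate_mset (nat (num x)) 2
      + replicate_mset (nat (den x - num x)) 3 + image_mset Suc E'"
    using end_degrees_farey_F[OF x(1,2)] x by (simp add: closed_degrees_def E E'_def)
  have "log_sum (closed_degrees x) = p * ln p + (q - 2 * p) * ln (q - 2 * p) + log_sum E'"
    unfolding C using E' ge
    by (subst log_sum_plus, force, subst log_sum_plus, force) (simp add: log_sum_replicate pq)
  moreover have "log_sum (closed_degrees (farey_F x)) = p * ln p + (q - p) * ln (q - p) + log_sum E'"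
    unfolding CF using E' ge
    by (subst log_sum_plus, force, subst log_sum_plus, force)
      (simp add: log_sum_replicate log_sum_image pq)
  moreover have "\<forall>k\<in>#closed_degrees x. 2 \<le> k" "\<forall>k\<in>#closed_degrees (farey_F x). 2 \<le> k"
    unfolding C CF using E2 by (auto split: if_splits)
  ultimately have "q * reduced_entropy x = (p + q) * reduced_entropy (farey_F x)"
    using den_haros_entropy[OF x(1,2)] den_haros_entropy[OF F(1) F1]
      den_reduced_entropy_left[OF x(1) assms(2) pq] den_reduced_entropy_left[OF F pqF]
    by (simp add: pqF(2)[symmetric] pq(2)[symmetric] algebra_simps)
  then have "q * reduced_entropy x = q * ((1 + real_of_rat x) * reduced_entropy (farey_F x))"
    unfolding farey_F_scaling[OF x(1) pq] .
  moreover have "q \<noteq> 0" using ge by (simp add: pq)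
  ultimately show ?thesis by (simp only: mult_cancel_left) simp
qed

text \<open>The computation of the left half, except that the \<open>2p - q\<close> nodes of degree
  5 enter the entropy at F(x) without a matching correction term; this produces the extra
  summands.\<close>

lemma reduced_entropy_farey_F_right:
  assumes "1 / 2 < x" "x < 1" and r: "r = real_of_rat x"
  shows "reduced_entropy x = (1 + r) * reduced_entropy (farey_F x)
    - r * ln r + (2 * r - 1) * ln (2 * r - 1) + (1 - r) * ln (1 - r)"
proof -
  define p q where pq: "p = real_of_int (num x)" "q = real_of_int (den x)"
  have x: "0 \<le> x" "x \<le> 1" "x \<noteq> 0" "x \<noteq> 1" "1 / 2 \<le> x" "0 < x" using assms by auto
  note F = farey_F_bounds[OF x(1,2)]
  have F1: "farey_F x \<le> 1" using F by simp
  have ge: "0 \<le> num x" "0 < den x" "den x \<le> 2 * num x" "num x < den x"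
    using den_le_two_num[OF x(5)] x assms num_nonneg[of x] den_pos[of x] num_less_den[of x] by simp_all
  have ge': "0 \<le> p" "0 < q" "0 \<le> 2 * p - q" "0 \<le> q - p" using ge by (simp_all add: pq)
  have pqF: "p = real_of_int (num (farey_F x))" "p + q = real_of_int (den (farey_F x))"
    using x by (simp_all add: pq num_den_farey_F)
  obtain E where E: "\<forall>e\<in>#E. 5 \<le> e"
    "haros_inner x = replicate_mset (nat (den x - num x)) 2
       + replicate_mset (nat (2 * num x - den x)) 3 + E"
    "haros_inner (farey_F x) = replicate_mset (nat (num x)) 2
       + replicate_mset (nat (den x - num x)) 3 + replicate_mset (nat (2 * num x - den x)) 5
       + image_mset Suc E"
    using haros_inner_right_half[OF x(5) assms(2)] by blast
  define E' where "E' = add_mset (first_degree x + last_degree x) E"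
  \<comment> \<open>Since \<open>x\<close> exceeds 1/2, the boundary degree is at least 3 + 2. After
    the shift all of \<open>E'\<close> is at least 6 and avoids the new degree 5.\<close>
  have E': "\<forall>e\<in>#E'. 5 \<le> e"
    using E(1) first_degree_ge_3[OF assms(1,2)] end_degrees_ge_2[OF x(6) assms(2)]
    by (auto simp: E'_def)
  then have E2: "\<forall>e\<in>#E'. 2 \<le> e" by force
  have C: "closed_degrees x = replicate_mset (nat (den x - num x)) 2
      + replicate_mset (nat (2 * num x - den x)) 3 + E'"
    by (simp add: closed_degrees_def E E'_def)
  have CF: "closed_degrees (farey_F x) = replicate_mset (nat (num x)) 2
      + replicate_mset (nat (den x - num x)) 3 + replicate_mset (nat (2 * num x - den x)) 5
      + image_mset Suc E'"
    using end_degrees_farey_F[OF x(1,2)] x by (simp add: closed_degrees_def E E'_def)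
  have "log_sum (closed_degrees x) =
      (q - p) * ln (q - p) + (2 * p - q) * ln (2 * p - q) + log_sum E'"
    unfolding C using E' ge
    by (subst log_sum_plus, force, subst log_sum_plus, force) (simp add: log_sum_replicate pq)
  moreover have "log_sum (closed_degrees (farey_F x)) =
      p * ln p + (q - p) * ln (q - p) + (2 * p - q) * ln (2 * p - q) + log_sum E'"
    unfolding CF using E' ge
    by (subst log_sum_plus, force, subst log_sum_plus, force, subst log_sum_plus, force)
      (simp add: log_sum_replicate log_sum_image pq)
  moreover have "\<forall>k\<in>#closed_degrees x. 2 \<le> k" "\<forall>k\<in>#closed_degrees (farey_F x). 2 \<le> k"
    unfolding C CF using E2 by (auto split: if_splits)
  ultimately have "q * reduced_entropy x = (p + q) * reduced_entropy (farey_F x)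
      - p * ln p + (2 * p - q) * ln (2 * p - q) + (q - p) * ln (q - p)"
    using den_haros_entropy[OF x(1,2)] den_haros_entropy[OF F(1) F1]
      den_reduced_entropy_right[OF x(5,2) pq] den_reduced_entropy_left[OF F pqF]
    by (simp add: pqF(2)[symmetric] pq(2)[symmetric] algebra_simps)
  \<comment> \<open>Dividing by \<open>q\<close> inside the logarithms is free: the weights -p, 2p -
    q and q - p sum to zero.\<close>
  also have "\<dots> = q * ((1 + r) * reduced_entropy (farey_F x))
      - p * ln (p / q) + (2 * p - q) * ln ((2 * p - q) / q) + (q - p) * ln ((q - p) / q)"
    unfolding r farey_F_scaling[OF x(1) pq] mult_ln_divide[OF ge'(1,2)]
      mult_ln_divide[OF ge'(3,2)] mult_ln_divide[OF ge'(4,2)]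
    by (simp add: algebra_simps)
  also have "\<dots> = q * ((1 + r) * reduced_entropy (farey_F x)
      - r * ln r + (2 * r - 1) * ln (2 * r - 1) + (1 - r) * ln (1 - r))"
  proof -
    have 1: "2 * r - 1 = (2 * p - q) / q" "1 - r = (q - p) / q" and 2: "r = p / q"
      using ge' by (simp_all add: r of_rat_num_den pq field_simps)
    have "q * (A - p / q * B + (2 * p - q) / q * C + (q - p) / q * D) =
        q * A - p * B + (2 * p - q) * C + (q - p) * D"
      for A B C D using ge' by (simp add: field_simps)
    then show ?thesis unfolding 1 unfolding 2 by simp
  qed
  finally show ?thesis using ge' by simp
qed

text \<open>The values for the end points 0 and 1, to which the multiplicity formulas do not extend;
  F(1) = 1/2 calls for the third.\<close>

lemma reduced_entropy_0: "reduced_entropy 0 = 0"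
  and reduced_entropy_1: "reduced_entropy 1 = 0"
  and reduced_entropy_half: "reduced_entropy (1 / 2) = 0"
proof -
  have C: "closed_degrees 0 = {#2#}" "closed_degrees 1 = {#2#}" "closed_degrees (1 / 2) = {#2, 4#}"
    using degrees_half
    by (simp_all add: closed_degrees_def haros_graph_0 haros_graph_1 degrees_G0)
  have "haros_entropy 0 = 0" "haros_entropy 1 = 0"
    using den_haros_entropy[of 0] den_haros_entropy[of 1] by (simp_all add: C log_sum_def)
  then show "reduced_entropy 0 = 0" "reduced_entropy 1 = 0"
    by (simp_all add: reduced_entropy_def)
  have "haros_entropy (1 / 2) = ln 2"
    using den_haros_entropy[of "1 / 2"] num_den_half by (simp add: C log_sum_def)
  then show "reduced_entropy (1 / 2) = 0"
    using den_reduced_entropy_left[of "1 / 2" 1 2] num_den_half by simp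
qed

theorem theorem13:
  fixes x :: rat
  assumes "0 \<le> x" and "x \<le> 1"
  shows "(x \<le> 1 / 2 \<longrightarrow>
           reduced_entropy x = (1 + real_of_rat x) * reduced_entropy (farey_F x)) \<and>
         (1 / 2 \<le> x \<longrightarrow>
           reduced_entropy x = (1 + real_of_rat x) * reduced_entropy (farey_F x)
             - real_of_rat x * ln (real_of_rat x)
             + (2 * real_of_rat x - 1) * ln (2 * real_of_rat x - 1)
             + (1 - real_of_rat x) * ln (1 - real_of_rat x))"
proof -
  consider "x = 0" | "x = 1" | "x = 1 / 2" | "0 < x" "x < 1 / 2" | "1 / 2 < x" "x < 1"
    using assms by force
  then show ?thesis
  proof cases
    case 1
    then show ?thesis by (simp add: farey_F_0 reduced_entropy_0)
  next
    case 2
    then show ?thesis using reduced_entropy_half by (simp add: farey_F_1 reduced_entropy_1)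
  next
    case 3
    then have r: "real_of_rat x = 1 / 2" by (simp only: of_rat_divide of_rat_1 of_rat_numeral_eq)
    have "0 < x" "x \<le> 1 / 2" using 3 by simp_all
    \<comment> \<open>Both branches apply at 1/2 and agree: the outer extra terms cancel and the
      middle one has factor 0.\<close>
    then show ?thesis using reduced_entropy_farey_F_left[of x] unfolding r by simp
  next
    case 4
    then show ?thesis using reduced_entropy_farey_F_left[of x] by simp
  next
    case 5
    then show ?thesis using reduced_entropy_farey_F_right[of x] by simp
  qed
qed

end
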